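(* Let $p\neq 3$ be a prime and $\mathbf{k}$ a field of characteristic $p$. Define $$\widetilde{\mathcal{I}}_p=\begin{cases}\mathcal{I}_p+\tfrac13 t^p(\alpha_1^p-\alpha_1-\alpha_2^p+\alpha_2), & p\geq5,\\ \mathcal{I}_2+(1+t^2)(\alpha_1^2+\alpha_1+\alpha_2^2+\alpha_2), & p=2.\end{cases}$$ Then $\widetilde{\mathcal{I}}_p$ is invariant under the extended affine Weyl group action: $w(\widetilde{\mathcal{I}}_p)=\widetilde{\mathcal{I}}_p$ for every $w$ in the group $\widetilde W(A_2^{(1)})$ of field automorphisms generated by $s_0,s_1,s_2,\pi$.
   Context: On $\mathbf{k}(f,g,\alpha_1,\alpha_2,t)$ let $s_0,s_1,s_2,\pi$ be the $\mathbf{k}$-linear field automorphisms fixing $t$ and acting by: $s_0:\ \alpha_1\mapsto 1-\alpha_2,\ \alpha_2\mapsto1-\alpha_1,\ f\mapsto f+\frac{\alpha_1+\alpha_2-1}{f-g+t},\ g\mapsto g+\frac{\alpha_1+\alpha_2-1}{f-g+t}$; $s_1:\ \alpha_1\mapsto-\alpha_1,\ \alpha_2\mapsto\alpha_1+\alpha_2,\ f\mapsto f,\ g\mapsto g-\frac{\alpha_1}{f}$; $s_2:\ \alpha_1\mapsto\alpha_1+\alpha_2,\ \alpha_2\mapsto-\alpha_2,\ f\mapsto f+\frac{\alpha_2}{g},\ g\mapsto g$; $\pi:\ \alpha_1\mapsto\alpha_2,\ \alpha_2\mapsto1-\alpha_1-\alpha_2,\ f\mapsto -g,\ g\mapsto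 f-g+t$. Define the $2\times2$ matrix polynomial in $z$ $$A(z)=\begin{bmatrix}w&0\\0&1\end{bmatrix}\begin{bmatrix}1&0\\ f-tfg-tz&1\end{bmatrix}\begin{bmatrix}g&1\\ z+\alpha_2&0\end{bmatrix}\begin{bmatrix}-f&1\\ z&0\end{bmatrix}\begin{bmatrix}tz-g+tfg&1\\ z-\alpha_1&0\end{bmatrix}\begin{bmatrix}w^{-1}&0\\0&1\end{bmatrix}$$ and $\mathcal{I}_p:=\operatorname{Tr}[A(p-1)A(p-2)\cdots A(1)A(0)]$ computed in characteristic $p$, an element of $\mathbb{F}_p[f,g,\alpha_1,\alpha_2,t]$ independent of $w$, viewed in $\mathbf{k}(f,g,\alpha_1,\alpha_2,t)$. *)

theory Defs
  imports "HOL-Analysis.Determinants" "HOL-Computational_Algebra.Polynomial"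
          "HOL-Computational_Algebra.Fraction_Field"
begin

text \<open>The polynomial ring k[f,g,alpha1,alpha2,t] as nested univariate polynomials
  (innermost variable f, then g, alpha1, alpha2, outermost t) and its fraction field
  k(f,g,alpha1,alpha2,t).\<close>

type_synonym 'k R5 = "'k poly poly poly poly poly"
type_synonym 'k F5 = "'k R5 fract"

definition emb :: "'k::idom R5 \<Rightarrow> 'k F5" where
  "emb x = Fract x 1"

definition kconst :: "'k::idom \<Rightarrow> 'k F5" where
  "kconst c = emb [:[:[:[:[:c:]:]:]:]:]"

definition var_t :: "'k::idom F5" where "var_t = emb [:0, 1:]"
definition var_a2 :: "'k::idom F5" where "var_a2 = emb [:[:0, 1:]:]"
definition var_a1 :: "'k::idom F5" where "var_a1 = emb [:[:[:0, 1:]:]:]"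
definition var_g :: "'k::idom F5" where "var_g = emb [:[:[:[:0, 1:]:]:]:]"
definition var_f :: "'k::idom F5" where "var_f = emb [:[:[:[:[:0, 1:]:]:]:]:]"

definition subst5 :: "'k::idom F5 \<Rightarrow> 'k F5 \<Rightarrow> 'k F5 \<Rightarrow> 'k F5 \<Rightarrow> 'k F5 \<Rightarrow> 'k R5 \<Rightarrow> 'k F5" where
  "subst5 xf xg xa1 xa2 xt P =
     poly (map_poly (\<lambda>P4. poly (map_poly (\<lambda>P3. poly (map_poly (\<lambda>P2.
        poly (map_poly (\<lambda>P1. poly (map_poly kconst P1) xf) P2) xg) P3) xa1) P4) xa2) P) xt"

text \<open>The k-linear field endomorphism of k(f,g,alpha1,alpha2,t) determined by the
  images of the generators (extended to fractions a/b as subst(a)/subst(b)).\<close>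
definition ext_hom :: "'k::idom F5 \<Rightarrow> 'k F5 \<Rightarrow> 'k F5 \<Rightarrow> 'k F5 \<Rightarrow> 'k F5 \<Rightarrow> 'k F5 \<Rightarrow> 'k F5" where
  "ext_hom xf xg xa1 xa2 xt q =
     (let (a, b) = (SOME (a, b). b \<noteq> 0 \<and> q = Fract a b)
      in subst5 xf xg xa1 xa2 xt a / subst5 xf xg xa1 xa2 xt b)"

definition s0 :: "'k::field F5 \<Rightarrow> 'k F5" where
  "s0 = ext_hom
     (var_f + (var_a1 + var_a2 - 1) / (var_f - var_g + var_t))
     (var_g + (var_a1 + var_a2 - 1) / (var_f - var_g + var_t))
     (1 - var_a2) (1 - var_a1) var_t"

definition s1 :: "'k::field F5 \<Rightarrow> 'k F5" where
  "s1 = ext_hom var_f (var_g - var_a1 / var_f) (- var_a1) (var_a1 + var_a2) var_t"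

definition s2 :: "'k::field F5 \<Rightarrow> 'k F5" where
  "s2 = ext_hom (var_f + var_a2 / var_g) var_g (var_a1 + var_a2) (- var_a2) var_t"

definition piW :: "'k::field F5 \<Rightarrow> 'k F5" where
  "piW = ext_hom (- var_g) (var_f - var_g + var_t) var_a2 (1 - var_a1 - var_a2) var_t"

definition Wgens :: "('k::field F5 \<Rightarrow> 'k F5) set" where
  "Wgens = {s0, s1, s2, piW}"

inductive_set Wgroup :: "('k::field F5 \<Rightarrow> 'k F5) set" where
  Wid: "id \<in> Wgroup"
| Wgen: "w \<in> Wgroup \<Longrightarrow> s \<in> Wgens \<Longrightarrow> s \<circ> w \<in> Wgroup"
| Winv: "w \<in> Wgroup \<Longrightarrow> s \<in> Wgens \<Longrightarrow> inv s \<circ> w \<in> Wgroup"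

definition mat2 :: "'a::zero \<Rightarrow> 'a \<Rightarrow> 'a \<Rightarrow> 'a \<Rightarrow> 'a^2^2" where
  "mat2 a b c d = (\<chi> i j. if i = 1 then (if j = 1 then a else b) else (if j = 1 then c else d))"

definition Amat :: "'k::field F5 \<Rightarrow> 'k F5 \<Rightarrow> 'k F5^2^2" where
  "Amat w z =
     mat2 w 0 0 1
     ** mat2 1 0 (var_f - var_t * var_f * var_g - var_t * z) 1
     ** mat2 var_g 1 (z + var_a2) 0
     ** mat2 (- var_f) 1 z 0
     ** mat2 (var_t * z - var_g + var_t * var_f * var_g) 1 (z - var_a1) 0
     ** mat2 (inverse w) 0 0 1"

text \<open>prodA n = A(n-1) A(n-2) ... A(1) A(0), taken with w = 1 (the trace is independent of w).\<close>
primrec prodA :: "nat \<Rightarrow> 'k::field F5^2^2" where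
  "prodA 0 = mat 1"
| "prodA (Suc n) = Amat 1 (of_nat n) ** prodA n"

definition Ip :: "nat \<Rightarrow> 'k::field F5" where
  "Ip p = trace (prodA p)"

definition Itilde :: "nat \<Rightarrow> 'k::field F5" where
  "Itilde p =
     (if p = 2 then Ip 2 + (1 + var_t ^ 2) * (var_a1 ^ 2 + var_a1 + var_a2 ^ 2 + var_a2)
      else Ip p + (1 / 3) * var_t ^ p * (var_a1 ^ p - var_a1 - var_a2 ^ p + var_a2))"

end

(* The gauge transformation by mat2 (t z - g + t f g) 1 (z - a1) 0 turns A into
   L(f - g + t, z + 1 - a1) L(g, z + a2) L(-f, z), where L(x, q) is the matrix with rows
   (x, 1) and (q, 0). In this cyclic word of 3p factors, s0, s1, s2 exchange two adjacent
   parameters q (a gauge transformation constant in z) and pi rotates the word; in all cases the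
   parameters are recovered only up to a common shift of z. The trace is a polynomial in z, and
   shifting z changes it by t^p (z^p - z) for odd p, and by (1 + t^2) (z^2 - z) for p = 2;
   the correction term of the invariant compensates exactly this.

   For odd p expand the trace over closed paths in {1, 2} of length p. The two constant paths
   contribute the diagonal entries' products, whose dependence on z is t^p (z^p - z). The
   others come in full rotation orbits, and rotating amounts to shifting z by an element of the
   prime field; a sum of such shifts of a polynomial of degree at most 3p/2 is constant. *)
theory Submission
  imports Defs
begin

section \<open>Substitutions as field endomorphisms\<close>

locale ring_map =
  fixes h :: "'a::comm_ring_1 \<Rightarrow> 'b::comm_ring_1"
  assumes one: "h 1 = 1"
    and add: "h (x + y) = h x + h y"
    and mult: "h (x * y) = h x * h y"
begin

lemma zero: "h 0 = 0"
  using add[of 0 0] by simp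

lemma minus: "h (- x) = - h x"
  using add[of x "- x"] by (simp add: zero eq_neg_iff_add_eq_0 add.commute)

lemma diff: "h (x - y) = h x - h y"
  using add[of x "- y"] by (simp add: minus)

lemma power: "h (x ^ n) = h x ^ n"
  by (induction n) (simp_all add: one mult)

lemma of_nat: "h (of_nat n) = of_nat n"
  by (induction n) (simp_all add: zero one add)

lemma numeral: "h (numeral n) = numeral n"
  using of_nat[of "numeral n"] by simp

lemmas hom_simps = zero one add mult minus diff power of_nat numeral

end

lemma ring_map_divide:
  fixes h :: "'a::field \<Rightarrow> 'b::field"
  assumes "ring_map h"
  shows "h (x / y) = h x / h y"
proof (cases "y = 0")
  case True
  then show ?thesis by (simp add: ring_map.zero[OF assms])
next
  case False
  have "h y * h (1 / y) = 1"
    using False by (simp add: ring_map.mult[OF assms, symmetric] ring_map.one[OF assms])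
  then have "h y \<noteq> 0" "h (1 / y) = 1 / h y"
    by (auto simp: eq_divide_eq mult.commute)
  then show ?thesis
    using ring_map.mult[OF assms, of x "1 / y"] by simp
qed

lemma ring_map_inj:
  fixes h :: "'a::field \<Rightarrow> 'b::field"
  assumes "ring_map h"
  shows "inj h"
proof (rule injI)
  fix x y assume "h x = h y"
  then have 0: "h (x - y) = 0" by (simp add: ring_map.diff[OF assms])
  show "x = y"
  proof (rule ccontr)
    assume "x \<noteq> y"
    then have "h ((x - y) * (1 / (x - y))) = 1" by (simp add: ring_map.one[OF assms])
    then show False using 0 by (simp only: ring_map.mult[OF assms]) simp
  qed
qed

text \<open>Coefficient map followed by evaluation is again a ring map; applied once per variable,
  five times in all, this makes \<open>subst5\<close> a ring map on the nested polynomials.\<close>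

lemma ring_map_eval:
  assumes "ring_map h"
  shows "ring_map (\<lambda>P. poly (map_poly h P) x)"
proof -
  interpret ring_map h by fact
  have add': "poly (map_poly h (P + Q)) x = poly (map_poly h P) x + poly (map_poly h Q) x" for P Q
    by (induction P Q rule: poly_induct2)
      (simp_all add: map_poly_pCons hom_simps algebra_simps)
  have smult': "poly (map_poly h (smult c P)) x = h c * poly (map_poly h P) x" for c P
    by (induction P) (simp_all add: map_poly_pCons hom_simps algebra_simps)
  have mult': "poly (map_poly h (P * Q)) x = poly (map_poly h P) x * poly (map_poly h Q) x" for P Q
    by (induction P)
      (simp_all add: map_poly_pCons hom_simps add' smult' algebra_simps)
  show ?thesis
    by standard (simp_all add: add' mult' hom_simps map_poly_1)
qed

lemma ring_map_emb: "ring_map (emb :: 'k::idom R5 \<Rightarrow> 'k F5)"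
  by standard (simp_all add: emb_def One_fract_def)

lemma emb_eq_0_iff: "emb x = 0 \<longleftrightarrow> x = 0"
  by (simp add: emb_def Zero_fract_def eq_fract)

lemma ring_map_kconst: "ring_map (kconst :: 'k::idom \<Rightarrow> 'k F5)"
  by standard (simp_all add: kconst_def flip: ring_map.add[OF ring_map_emb]
      ring_map.mult[OF ring_map_emb] ring_map.one[OF ring_map_emb] one_pCons, simp_all add: mult.commute)

lemma ring_map_subst5:
  "ring_map (subst5 xf xg xa xb xt :: 'k::idom R5 \<Rightarrow> 'k F5)"
  unfolding subst5_def by (intro ring_map_eval ring_map_kconst)

lemma subst5_generators:
  fixes xf :: "'k::idom F5"
  shows "subst5 xf xg xa xb xt [:0, 1:] = xt"
    "subst5 xf xg xa xb xt [:[:0, 1:]:] = xb"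
    "subst5 xf xg xa xb xt [:[:[:0, 1:]:]:] = xa"
    "subst5 xf xg xa xb xt [:[:[:[:0, 1:]:]:]:] = xg"
    "subst5 xf xg xa xb xt [:[:[:[:[:0, 1:]:]:]:]:] = xf"
    "subst5 xf xg xa xb xt [:[:[:[:[:c:]:]:]:]:] = kconst c"
  using ring_map.zero[OF ring_map_kconst[where ?'k = 'k]] ring_map.one[OF ring_map_kconst[where ?'k = 'k]]
  by (simp_all add: subst5_def map_poly_pCons map_poly_1)

lemma poly_gen_induct:
  fixes P :: "'a::comm_ring_1 poly \<Rightarrow> bool"
  assumes "\<And>c. P [:c:]" "P [:0, 1:]" "\<And>p q. P p \<Longrightarrow> P q \<Longrightarrow> P (p + q)"
    "\<And>p q. P p \<Longrightarrow> P q \<Longrightarrow> P (p * q)"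
  shows "P p"
proof (induction p)
  case 0
  show ?case using assms(1)[of 0] by simp
next
  case (pCons a p)
  have "pCons a p = [:a:] + [:0, 1:] * p" by simp
  with pCons assms show ?case by metis
qed

text \<open>Peels the nested polynomials one variable at a time, so a property closed under sums and
  products has to be checked only on constants and the five variables.\<close>

lemma R5_induct:
  fixes P :: "'k::idom R5 \<Rightarrow> bool"
  assumes const: "\<And>c. P [:[:[:[:[:c:]:]:]:]:]"
    and gens: "P [:[:[:[:[:0, 1:]:]:]:]:]" "P [:[:[:[:0, 1:]:]:]:]" "P [:[:[:0, 1:]:]:]"
      "P [:[:0, 1:]:]" "P [:0, 1:]"
    and add: "\<And>p q. P p \<Longrightarrow> P q \<Longrightarrow> P (p + q)"
    and mult: "\<And>p q. P p \<Longrightarrow> P q \<Longrightarrow> P (p * q)"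
  shows "P p"
proof -
  have 1: "P [:[:[:[:a:]:]:]:]" for a
    by (rule poly_gen_induct[where P = "\<lambda>a. P [:[:[:[:a:]:]:]:]"])
      (use const gens add[of "[:[:[:[:_:]:]:]:]" "[:[:[:[:_:]:]:]:]"]
        mult[of "[:[:[:[:_:]:]:]:]" "[:[:[:[:_:]:]:]:]"] in auto)
  have 2: "P [:[:[:a:]:]:]" for a
    by (rule poly_gen_induct[where P = "\<lambda>a. P [:[:[:a:]:]:]"])
      (use 1 gens add[of "[:[:[:_:]:]:]" "[:[:[:_:]:]:]"] mult[of "[:[:[:_:]:]:]" "[:[:[:_:]:]:]"] in auto)
  have 3: "P [:[:a:]:]" for a
    by (rule poly_gen_induct[where P = "\<lambda>a. P [:[:a:]:]"])
      (use 2 gens add[of "[:[:_:]:]" "[:[:_:]:]"] mult[of "[:[:_:]:]" "[:[:_:]:]"] in auto)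
  have 4: "P [:a:]" for a
    by (rule poly_gen_induct[where P = "\<lambda>a. P [:a:]"])
      (use 3 gens add[of "[:_:]" "[:_:]"] mult[of "[:_:]" "[:_:]"] in auto)
  show ?thesis
    by (rule poly_gen_induct) (use 4 gens add mult in auto)
qed

section \<open>Injectivity of substitutions and their extension to fractions\<close>

definition frac_ext :: "('a::idom \<Rightarrow> 'b::field) \<Rightarrow> 'a fract \<Rightarrow> 'b \<Rightarrow> bool" where
  "frac_ext \<psi> x y \<longleftrightarrow> (\<exists>a b. \<psi> b \<noteq> 0 \<and> x = Fract a b \<and> y = \<psi> a / \<psi> b)"

context
  fixes \<psi> :: "'a::idom \<Rightarrow> 'b::field"
  assumes hom: "ring_map \<psi>"
begin

interpretation ring_map \<psi> by (fact hom)

lemma frac_ext_zero: "frac_ext \<psi> 0 y \<Longrightarrow> y = 0"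
  unfolding frac_ext_def Zero_fract_def by (metis eq_fract(1) hom_simps(1) mult_1_right mult_zero_left
      div_0 zero_neq_one mult_eq_0_iff)

lemma frac_ext_base: "frac_ext \<psi> (Fract a 1) (\<psi> a)"
  unfolding frac_ext_def by (rule exI[of _ a], rule exI[of _ 1]) (simp add: hom_simps)

lemma frac_ext_one: "frac_ext \<psi> 1 1"
  using frac_ext_base[of 1] by (simp add: hom_simps One_fract_def)

lemma frac_ext_add:
  assumes "frac_ext \<psi> x y" "frac_ext \<psi> x' y'"
  shows "frac_ext \<psi> (x + x') (y + y')"
proof -
  obtain a b a' b' where *: "\<psi> b \<noteq> 0" "x = Fract a b" "y = \<psi> a / \<psi> b"
    "\<psi> b' \<noteq> 0" "x' = Fract a' b'" "y' = \<psi> a' / \<psi> b'"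
    using assms unfolding frac_ext_def by blast
  have "b \<noteq> 0" "b' \<noteq> 0" using * zero by metis+
  with * show ?thesis unfolding frac_ext_def
    by (intro exI[of _ "a * b' + a' * b"] exI[of _ "b * b'"]) (simp add: hom_simps field_simps)
qed

lemma frac_ext_mult:
  assumes "frac_ext \<psi> x y" "frac_ext \<psi> x' y'"
  shows "frac_ext \<psi> (x * x') (y * y')"
proof -
  obtain a b a' b' where *: "\<psi> b \<noteq> 0" "x = Fract a b" "y = \<psi> a / \<psi> b"
    "\<psi> b' \<noteq> 0" "x' = Fract a' b'" "y' = \<psi> a' / \<psi> b'"
    using assms unfolding frac_ext_def by blast
  then show ?thesis unfolding frac_ext_def
    by (intro exI[of _ "a * a'"] exI[of _ "b * b'"]) (simp add: hom_simps)
qed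

lemma frac_ext_minus:
  assumes "frac_ext \<psi> x y"
  shows "frac_ext \<psi> (- x) (- y)"
  using frac_ext_mult[OF frac_ext_base[of "- 1"] assms]
  by (simp add: hom_simps flip: minus_fract One_fract_def)

lemma frac_ext_diff:
  assumes "frac_ext \<psi> x y" "frac_ext \<psi> x' y'"
  shows "frac_ext \<psi> (x - x') (y - y')"
  using frac_ext_add[OF assms(1) frac_ext_minus[OF assms(2)]] by simp

text \<open>The value \<open>y'\<close> must not vanish: its numerator becomes the denominator of
  the reciprocal, and \<open>\<psi>\<close> has to be nonzero there.\<close>

lemma frac_ext_divide:
  assumes "frac_ext \<psi> x y" "frac_ext \<psi> x' y'" "y' \<noteq> 0"
  shows "frac_ext \<psi> (x / x') (y / y')"
proof -
  obtain a b where *: "\<psi> b \<noteq> 0" "x' = Fract a b" "y' = \<psi> a / \<psi> b"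
    using assms(2) unfolding frac_ext_def by blast
  have "\<psi> a \<noteq> 0" using * assms(3) by auto
  then have "frac_ext \<psi> (inverse x') (inverse y')" unfolding frac_ext_def
    using * by (intro exI[of _ b] exI[of _ a]) (auto simp: hom_simps)
  from frac_ext_mult[OF assms(1) this] show ?thesis by (simp add: divide_inverse)
qed

end

text \<open>A substitution is injective as soon as some substitution \<open>\<psi>\<close> undoes it on the generators.
  As \<open>\<psi>\<close> is not yet known to extend to the whole field of fractions, its extension is only
  used as a relation.\<close>

lemma subst5_inj:
  fixes xf xg xa xb xt yf yg ya yb yt :: "'k::idom F5"
  defines "\<phi> \<equiv> subst5 xf xg xa xb xt" and "\<psi> \<equiv> subst5 yf yg ya yb yt"
  assumes "frac_ext \<psi> xf var_f" "frac_ext \<psi> xg var_g" "frac_ext \<psi> xa var_a1"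
    "frac_ext \<psi> xb var_a2" "frac_ext \<psi> xt var_t"
    and "\<phi> P = 0"
  shows "P = 0"
proof -
  have \<psi>: "ring_map \<psi>" and \<phi>: "ring_map \<phi>"
    unfolding \<phi>_def \<psi>_def by (rule ring_map_subst5)+
  have "frac_ext \<psi> (\<phi> P) (emb P)"
  \<comment> \<open>\<open>\<psi>\<close> after \<open>\<phi>\<close> is the identity on the
    generators, hence on every polynomial.\<close>
  proof (induction P rule: R5_induct)
    case (1 c)
    show ?case
      using frac_ext_base[OF \<psi>, of "[:[:[:[:[:c:]:]:]:]:]"]
      by (simp add: \<phi>_def \<psi>_def subst5_generators kconst_def emb_def)
  next
    case (7 p q)
    then show ?case
      by (simp add: ring_map.add[OF \<phi>] ring_map.add[OF ring_map_emb] frac_ext_add[OF \<psi>])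
  next
    case (8 p q)
    then show ?case
      by (simp add: ring_map.mult[OF \<phi>] ring_map.mult[OF ring_map_emb] frac_ext_mult[OF \<psi>])
  qed (use assms(3-7) in \<open>simp_all add: \<phi>_def subst5_generators var_f_def var_g_def var_a1_def
      var_a2_def var_t_def\<close>)
  with assms(8) have "emb P = 0" using frac_ext_zero[OF \<psi>] by simp
  then show ?thesis by (simp add: emb_eq_0_iff)
qed

text \<open>The choice operator in \<open>ext_hom\<close> may pick any representation of the
  fraction. Cross-multiplying two representations shows that the quotient is the same, and
  injectivity keeps both denominators nonzero after substitution.\<close>

lemma ext_hom_Fract:
  fixes xf :: "'k::idom F5"
  assumes inj: "\<And>P. subst5 xf xg xa xb xt P = 0 \<Longrightarrow> P = 0" and "b \<noteq> 0"
  shows "ext_hom xf xg xa xb xt (Fract a b)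
    = subst5 xf xg xa xb xt a / subst5 xf xg xa xb xt b"
proof -
  let ?\<phi> = "subst5 xf xg xa xb xt"
  interpret ring_map ?\<phi> by (rule ring_map_subst5)
  define ab where "ab = (SOME (c, d). d \<noteq> 0 \<and> Fract a b = Fract c d)"
  obtain c d where cd: "ab = (c, d)" by (cases ab)
  have "case ab of (c, d) \<Rightarrow> d \<noteq> 0 \<and> Fract a b = Fract c d"
    unfolding ab_def by (rule someI[of _ "(a, b)"]) (simp add: \<open>b \<noteq> 0\<close>)
  then have d: "d \<noteq> 0" "a * d = c * b"
    using \<open>b \<noteq> 0\<close> eq_fract(1)[of b d a c] by (auto simp: cd)
  have nz: "?\<phi> b \<noteq> 0" "?\<phi> d \<noteq> 0"
    using inj d \<open>b \<noteq> 0\<close> by blast+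
  have "?\<phi> a * ?\<phi> d = ?\<phi> c * ?\<phi> b"
    using d by (simp flip: mult)
  then have "?\<phi> c / ?\<phi> d = ?\<phi> a / ?\<phi> b"
    using nz by (simp add: field_simps)
  then show ?thesis
    unfolding ext_hom_def ab_def[symmetric] cd by simp
qed

lemma ext_hom_ring_map:
  fixes xf :: "'k::idom F5"
  assumes inj: "\<And>P. subst5 xf xg xa xb xt P = 0 \<Longrightarrow> P = 0"
  shows "ring_map (ext_hom xf xg xa xb xt)"
proof -
  let ?\<phi> = "subst5 xf xg xa xb xt" and ?h = "ext_hom xf xg xa xb xt"
  interpret ring_map ?\<phi> by (rule ring_map_subst5)
  note F = ext_hom_Fract[OF inj]
  have nz: "?\<phi> b \<noteq> 0" if "b \<noteq> 0" for b using inj that by blast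
  show ?thesis
  proof
    show "?h 1 = 1" by (simp add: One_fract_def F hom_simps)
    fix x y :: "'k F5"
    obtain a b where x: "x = Fract a b" "b \<noteq> 0" by (cases x)
    obtain c d where y: "y = Fract c d" "d \<noteq> 0" by (cases y)
    show "?h (x + y) = ?h x + ?h y"
      using x y nz by (simp add: F hom_simps field_simps)
    show "?h (x * y) = ?h x * ?h y"
      using x y by (simp add: F hom_simps)
  qed
qed

lemma ext_hom_generators:
  fixes xf :: "'k::idom F5"
  assumes inj: "\<And>P. subst5 xf xg xa xb xt P = 0 \<Longrightarrow> P = 0"
  shows "ext_hom xf xg xa xb xt var_f = xf" "ext_hom xf xg xa xb xt var_g = xg"
    "ext_hom xf xg xa xb xt var_a1 = xa" "ext_hom xf xg xa xb xt var_a2 = xb"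
    "ext_hom xf xg xa xb xt var_t = xt"
  using ring_map.one[OF ring_map_subst5, of xf xg xa xb xt]
  by (simp_all add: var_f_def var_g_def var_a1_def var_a2_def var_t_def emb_def
      ext_hom_Fract[OF inj] subst5_generators)

lemma var_nonzero:
  "var_f \<noteq> (0::'k::idom F5)" "var_g \<noteq> (0::'k F5)" "var_a1 \<noteq> (0::'k F5)" "var_a2 \<noteq> (0::'k F5)"
  by (simp_all add: var_f_def var_g_def var_a1_def var_a2_def emb_eq_0_iff)

text \<open>The first element is the denominator in \<open>s0\<close>; the other two conditions make
  gauge matrices invertible when the cyclic word is rotated.\<close>

lemma var_lin_nonzero:
  "var_f - var_g + var_t \<noteq> (0::'k::idom F5)" "1 + var_a1 \<noteq> (0::'k F5)" "var_a2 \<noteq> (1::'k F5)"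
  unfolding right_minus_eq[of _ 1, symmetric]
  by (simp_all add: var_f_def var_g_def var_a1_def var_a2_def var_t_def emb_eq_0_iff one_pCons
    flip: ring_map.add[OF ring_map_emb] ring_map.diff[OF ring_map_emb] ring_map.one[OF ring_map_emb])

lemma frac_ext_var:
  fixes yf yg ya yb yt :: "'k::idom F5"
  defines "\<psi> \<equiv> subst5 yf yg ya yb yt"
  shows "frac_ext \<psi> var_f yf" "frac_ext \<psi> var_g yg" "frac_ext \<psi> var_a1 ya"
    "frac_ext \<psi> var_a2 yb" "frac_ext \<psi> var_t yt"
  using frac_ext_base[OF ring_map_subst5, of yf yg ya yb yt]
  unfolding \<psi>_def var_f_def var_g_def var_a1_def var_a2_def var_t_def emb_def
  by (metis subst5_generators)+

lemmas frac_ext_intros =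
  frac_ext_add[OF ring_map_subst5] frac_ext_diff[OF ring_map_subst5]
  frac_ext_minus[OF ring_map_subst5] frac_ext_divide[OF ring_map_subst5]
  frac_ext_one[OF ring_map_subst5] frac_ext_var

lemma frac_ext_eq: "frac_ext \<psi> x y \<Longrightarrow> y = z \<Longrightarrow> frac_ext \<psi> x z"
  by simp

section \<open>The four generators as field endomorphisms\<close>

lemma s0_hom:
  fixes \<delta> :: "'k::field F5"
  defines "\<delta> \<equiv> (var_a1 + var_a2 - 1) / (var_f - var_g + var_t)"
  shows "ring_map (s0 :: 'k F5 \<Rightarrow> _)" "s0 var_f = var_f + \<delta>" "s0 var_g = var_g + \<delta>"
    "s0 var_a1 = (1 - var_a2 :: 'k F5)" "s0 var_a2 = (1 - var_a1 :: 'k F5)"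
    "s0 var_t = (var_t :: 'k F5)"
proof -
  have inj: "P = 0" if "subst5 (var_f + \<delta>) (var_g + \<delta>) (1 - var_a2) (1 - var_a1) var_t P = 0" for P
  \<comment> \<open>The reflection is an involution, so the undoing substitution is the same one:
    \<open>f - g + t\<close> is fixed and \<open>\<delta>\<close> changes sign. The same choice
    serves \<open>s1\<close> and \<open>s2\<close>.\<close>
  proof (rule subst5_inj[OF _ _ _ _ _ that, where yf = "var_f + \<delta>" and yg = "var_g + \<delta>" and ya = "1 - var_a2"
        and yb = "1 - var_a1" and yt = "var_t"])
  qed (unfold \<delta>_def, (rule frac_ext_eq, (rule frac_ext_intros |
      simp add: var_lin_nonzero flip: add_divide_distrib diff_divide_distrib)+)+)
  show "ring_map (s0 :: 'k F5 \<Rightarrow> _)" "s0 var_f = var_f + \<delta>" "s0 var_g = var_g + \<delta>"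
    "s0 var_a1 = (1 - var_a2 :: 'k F5)" "s0 var_a2 = (1 - var_a1 :: 'k F5)"
    "s0 var_t = (var_t :: 'k F5)"
    unfolding s0_def \<delta>_def[symmetric]
    using ext_hom_ring_map[OF inj] ext_hom_generators[OF inj] by simp_all
qed

lemma s1_hom:
  shows "ring_map (s1 :: 'k::field F5 \<Rightarrow> _)" "s1 var_f = (var_f :: 'k F5)"
    "s1 var_g = (var_g - var_a1 / var_f :: 'k F5)" "s1 var_a1 = (- var_a1 :: 'k F5)"
    "s1 var_a2 = (var_a1 + var_a2 :: 'k F5)" "s1 var_t = (var_t :: 'k F5)"
proof -
  have inj: "P = 0" if "subst5 var_f (var_g - var_a1 / var_f) (- var_a1) (var_a1 + var_a2) var_t P = 0"
    for P :: "'k R5"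
  proof (rule subst5_inj[OF _ _ _ _ _ that, where yf = "var_f" and yg = "var_g - var_a1 / var_f" and ya = "- var_a1"
        and yb = "var_a1 + var_a2" and yt = "var_t"])
  qed ((rule frac_ext_eq, (rule frac_ext_intros | simp add: var_nonzero)+)+)
  show "ring_map (s1 :: 'k F5 \<Rightarrow> _)" "s1 var_f = (var_f :: 'k F5)"
    "s1 var_g = (var_g - var_a1 / var_f :: 'k F5)" "s1 var_a1 = (- var_a1 :: 'k F5)"
    "s1 var_a2 = (var_a1 + var_a2 :: 'k F5)" "s1 var_t = (var_t :: 'k F5)"
    unfolding s1_def
    using ext_hom_ring_map[OF inj] ext_hom_generators[OF inj] by simp_all
qed

lemma s2_hom:
  shows "ring_map (s2 :: 'k::field F5 \<Rightarrow> _)" "s2 var_f = (var_f + var_a2 / var_g :: 'k F5)"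
    "s2 var_g = (var_g :: 'k F5)" "s2 var_a1 = (var_a1 + var_a2 :: 'k F5)"
    "s2 var_a2 = (- var_a2 :: 'k F5)" "s2 var_t = (var_t :: 'k F5)"
proof -
  have inj: "P = 0" if "subst5 (var_f + var_a2 / var_g) var_g (var_a1 + var_a2) (- var_a2) var_t P = 0"
    for P :: "'k R5"
  proof (rule subst5_inj[OF _ _ _ _ _ that, where yf = "var_f + var_a2 / var_g" and yg = "var_g"
        and ya = "var_a1 + var_a2" and yb = "- var_a2" and yt = "var_t"])
  qed ((rule frac_ext_eq, (rule frac_ext_intros | simp add: var_nonzero)+)+)
  show "ring_map (s2 :: 'k F5 \<Rightarrow> _)" "s2 var_f = (var_f + var_a2 / var_g :: 'k F5)"
    "s2 var_g = (var_g :: 'k F5)" "s2 var_a1 = (var_a1 + var_a2 :: 'k F5)"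
    "s2 var_a2 = (- var_a2 :: 'k F5)" "s2 var_t = (var_t :: 'k F5)"
    unfolding s2_def
    using ext_hom_ring_map[OF inj] ext_hom_generators[OF inj] by simp_all
qed

lemma piW_hom:
  shows "ring_map (piW :: 'k::field F5 \<Rightarrow> _)" "piW var_f = (- var_g :: 'k F5)"
    "piW var_g = (var_f - var_g + var_t :: 'k F5)" "piW var_a1 = (var_a2 :: 'k F5)"
    "piW var_a2 = (1 - var_a1 - var_a2 :: 'k F5)" "piW var_t = (var_t :: 'k F5)"
proof -
  have inj: "P = 0" if "subst5 (- var_g) (var_f - var_g + var_t) var_a2 (1 - var_a1 - var_a2) var_t P = 0"
    for P :: "'k R5"
  \<comment> \<open>Here pi has order 3 on the generators, and the undoing substitution is its
    square.\<close>
  proof (rule subst5_inj[OF _ _ _ _ _ that, where yf = "var_g - var_f - var_t" and yg = "- var_f"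
        and ya = "1 - var_a1 - var_a2" and yb = "var_a1" and yt = "var_t"])
  qed ((rule frac_ext_eq, (rule frac_ext_intros | simp add: var_nonzero)+)+)
  show "ring_map (piW :: 'k F5 \<Rightarrow> _)" "piW var_f = (- var_g :: 'k F5)"
    "piW var_g = (var_f - var_g + var_t :: 'k F5)" "piW var_a1 = (var_a2 :: 'k F5)"
    "piW var_a2 = (1 - var_a1 - var_a2 :: 'k F5)" "piW var_t = (var_t :: 'k F5)"
    unfolding piW_def
    using ext_hom_ring_map[OF inj] ext_hom_generators[OF inj] by simp_all
qed

section \<open>Cyclic products of matrices\<close>

primrec mprod :: "(nat \<Rightarrow> 'a::semiring_1^'n^'n) \<Rightarrow> nat \<Rightarrow> 'a^'n^'n" where
  "mprod M 0 = mat 1"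
| "mprod M (Suc n) = M n ** mprod M n"

lemma mprod_gauge:
  assumes "\<And>n. H (Suc n) ** A n = C n ** H n"
  shows "H n ** mprod A n = mprod C n ** H 0"
proof (induction n)
  case (Suc n)
  have "H (Suc n) ** mprod A (Suc n) = H (Suc n) ** A n ** mprod A n"
    by (simp add: matrix_mul_assoc)
  also have "\<dots> = C n ** (H n ** mprod A n)"
    by (simp only: assms matrix_mul_assoc)
  also have "\<dots> = mprod C (Suc n) ** H 0"
    by (simp only: Suc mprod.simps matrix_mul_assoc)
  finally show ?case .
qed simp

text \<open>The gauge factors telescope along the product. As \<open>H\<close> returns to its
  initial value after \<open>p\<close> steps, the two full products are conjugate by
  \<open>H 0\<close>.\<close>

lemma trace_mprod_gauge:
  fixes A C :: "nat \<Rightarrow> 'a::field^'n^'n"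
  assumes "\<And>n. H (Suc n) ** A n = C n ** H n" "H p = H 0" "invertible (H 0)"
  shows "trace (mprod A p) = trace (mprod C p)"
proof -
  obtain K where K: "H 0 ** K = mat 1" "K ** H 0 = mat 1"
    using assms(3) unfolding invertible_def by blast
  have "mprod C p = mprod C p ** (H 0 ** K)"
    by (simp only: K matrix_mul_rid)
  also have "\<dots> = (H 0 ** mprod A p) ** K"
    using mprod_gauge[of H A C, OF assms(1), of p] by (simp only: assms(2) matrix_mul_assoc)
  finally have "mprod C p = (H 0 ** mprod A p) ** K" .
  moreover have "trace (H 0 ** mprod A p ** K) = trace (K ** (H 0 ** mprod A p))"
    by (rule trace_mul_sym)
  moreover have "K ** (H 0 ** mprod A p) = mprod A p"
    by (simp only: matrix_mul_assoc K matrix_mul_lid)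
  ultimately show ?thesis by simp
qed

lemma mat2_nth [simp]:
  "mat2 a b c d $ 1 $ 1 = a" "mat2 a b c d $ 1 $ 2 = b"
  "mat2 a b c d $ 2 $ 1 = c" "mat2 a b c d $ 2 $ 2 = d"
  by (simp_all add: mat2_def)

lemma mat2_mult:
  "mat2 a b c d ** mat2 a' b' c' d' =
    mat2 (a * a' + b * c') (a * b' + b * d') (c * a' + d * c') (c * b' + d * (d' :: 'a::semiring_1))"
  by (simp add: vec_eq_iff matrix_matrix_mult_def sum_2 forall_2)

lemma invertible_mat2:
  assumes "a * d - b * c \<noteq> (0 :: 'a::field)"
  shows "invertible (mat2 a b c d)"
  using assms by (simp add: invertible_det_nz det_2)

definition Lmat :: "'a::field \<Rightarrow> 'a \<Rightarrow> 'a^2^2" where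
  "Lmat x q = mat2 x 1 q 0"

text \<open>Trace of the periodic word of \<open>3 * p\<close> factors. All three parameters grow by
  one per period, so adding \<open>z\<close> to each \<open>b\<close> is the shift of the spectral
  variable.\<close>

definition cyc :: "nat \<Rightarrow> 'a::field \<Rightarrow> 'a \<Rightarrow> 'a \<Rightarrow> 'a \<Rightarrow> 'a \<Rightarrow> 'a \<Rightarrow> 'a" where
  "cyc p x1 x2 x3 b1 b2 b3 =
    trace (mprod (\<lambda>n. Lmat x1 (b1 + of_nat n) ** Lmat x2 (b2 + of_nat n) ** Lmat x3 (b3 + of_nat n)) p)"

text \<open>The gauge matrix is the first factor one period earlier, which lowers its parameter by
  one. It is periodic because \<open>p\<close> vanishes in the field, and
  \<open>b1 \<noteq> 1\<close> makes its determinant at 0 nonzero.\<close>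

lemma cyc_rotate:
  fixes b1 :: "'a::field"
  assumes "of_nat p = (0::'a)" "b1 \<noteq> 1"
  shows "cyc p x1 x2 x3 b1 b2 b3 = cyc p x2 x3 x1 b2 b3 (b1 - 1)"
  unfolding cyc_def
  by (rule trace_mprod_gauge[symmetric, where H = "\<lambda>n. Lmat x1 (b1 - 1 + of_nat n)"])
    (use assms in \<open>simp_all add: matrix_mul_assoc Lmat_def invertible_mat2\<close>)

lemma cyc_swap:
  fixes x1 b1 b2 :: "'a::field"
  assumes "x1 \<noteq> 0"
  defines "d \<equiv> (b1 - b2) / x1"
  shows "cyc p x1 x2 x3 b1 b2 b3 = cyc p x1 (x2 - d) (x3 + d) b2 b1 b3"
proof -
  have b1: "b1 = b2 + x1 * d"
    using assms by simp
  show ?thesis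
    unfolding cyc_def b1
    by (rule trace_mprod_gauge[symmetric, where H = "\<lambda>n. mat2 1 0 d 1"])
      (simp_all add: Lmat_def mat2_mult invertible_mat2 algebra_simps)
qed

section \<open>Traces of products as sums over closed paths\<close>

definition path_weight :: "(nat \<Rightarrow> 'a::comm_semiring_1^'n^'n) \<Rightarrow> nat \<Rightarrow> 'n list \<Rightarrow> 'a" where
  "path_weight M n xs = (\<Prod>k<n. M k $ (xs ! Suc k) $ (xs ! k))"

definition loop_weight :: "(nat \<Rightarrow> 'a::comm_semiring_1^'n^'n) \<Rightarrow> nat \<Rightarrow> 'n list \<Rightarrow> 'a" where
  "loop_weight M n xs = (\<Prod>k<n. M k $ (xs ! (Suc k mod n)) $ (xs ! k))"

lemma finite_lists_length_UNIV: "finite {xs :: 'n::finite list. length xs = n}"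
  using finite_lists_length_eq[of "UNIV :: 'n set" n] by simp

lemma sum_lists_snoc:
  fixes f :: "'n::finite list \<Rightarrow> 'a::comm_monoid_add"
  shows "(\<Sum>xs | length xs = Suc n. f xs) = (\<Sum>c\<in>UNIV. \<Sum>xs | length xs = n. f (xs @ [c]))"
proof -
  have "(\<Sum>c\<in>UNIV. \<Sum>xs | length xs = n. f (xs @ [c]))
      = (\<Sum>(c, xs)\<in>UNIV \<times> {xs. length xs = n}. f (xs @ [c]))"
    by (rule sum.cartesian_product)
  also have "\<dots> = (\<Sum>xs | length xs = Suc n. f xs)"
  proof (rule sum.reindex_bij_witness[where i = "\<lambda>xs. (last xs, butlast xs)" and j = "\<lambda>(c, xs). xs @ [c]"])
    fix xs :: "'n list" assume "xs \<in> {xs. length xs = Suc n}"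
    then have "xs \<noteq> []" "length xs = Suc n" by auto
    then show "(case (last xs, butlast xs) of (c, xs) \<Rightarrow> xs @ [c]) = xs"
      "(last xs, butlast xs) \<in> UNIV \<times> {xs. length xs = n}"
      by auto
  qed auto
  finally show ?thesis ..
qed

text \<open>The factor \<open>M 0\<close> stands rightmost, so a path runs from the column index
  \<open>b\<close> to the row index \<open>a\<close>. Only the vertices before the end are summed;
  appending \<open>a\<close> makes the empty product come out right as well.\<close>

lemma mprod_path_sum:
  fixes M :: "nat \<Rightarrow> 'a::comm_semiring_1^'n::finite^'n"
  shows "mprod M n $ a $ b =
    (\<Sum>xs | length xs = n. if (xs @ [a]) ! 0 = b then path_weight M n (xs @ [a]) else 0)"
proof (induction n arbitrary: a)
  case 0
  then show ?case by (simp add: path_weight_def mat_def)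
next
  case (Suc n)
  have step: "(if (xs @ [c]) ! 0 = b then M n $ a $ c * path_weight M n (xs @ [c]) else 0)
      = (if ((xs @ [c]) @ [a]) ! 0 = b then path_weight M (Suc n) ((xs @ [c]) @ [a]) else 0)"
    if "length xs = n" for xs c
  proof -
    have "path_weight M n (xs @ [c, a]) = path_weight M n (xs @ [c])"
      unfolding path_weight_def by (rule prod.cong) (use that in \<open>auto simp: nth_append nth_Cons'\<close>)
    then show ?thesis
      using that by (auto simp: path_weight_def nth_append mult.commute)
  qed
  have "mprod M (Suc n) $ a $ b = (\<Sum>c\<in>UNIV. M n $ a $ c *
      (\<Sum>xs | length xs = n. if (xs @ [c]) ! 0 = b then path_weight M n (xs @ [c]) else 0))"
    by (simp add: matrix_matrix_mult_def Suc)
  also have "\<dots> = (\<Sum>c\<in>UNIV. \<Sum>xs | length xs = n.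
      if (xs @ [c]) ! 0 = b then M n $ a $ c * path_weight M n (xs @ [c]) else 0)"
    unfolding sum_distrib_left by (intro sum.cong refl) simp
  also have "\<dots> = (\<Sum>xs | length xs = Suc n.
      if (xs @ [a]) ! 0 = b then path_weight M (Suc n) (xs @ [a]) else 0)"
    unfolding sum_lists_snoc by (intro sum.cong refl step) simp
  finally show ?case .
qed

lemma trace_mprod_loop_sum:
  fixes M :: "nat \<Rightarrow> 'a::comm_semiring_1^'n::finite^'n"
  assumes "n > 0"
  shows "trace (mprod M n) = (\<Sum>xs | length xs = n. loop_weight M n xs)"
proof -
  have path: "path_weight M n (xs @ [xs ! 0]) = loop_weight M n xs" if "length xs = n" for xs
    unfolding path_weight_def loop_weight_def
  proof (intro prod.cong refl)
    fix k assume "k \<in> {..<n}"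
    then show "M k $ ((xs @ [xs ! 0]) ! Suc k) $ ((xs @ [xs ! 0]) ! k) = M k $ (xs ! (Suc k mod n)) $ (xs ! k)"
      using that by (cases "Suc k = n") (auto simp: nth_append)
  qed
  have loop: "(\<Sum>i\<in>UNIV. if (xs @ [i]) ! 0 = i then path_weight M n (xs @ [i]) else 0)
      = loop_weight M n xs" if "length xs = n" for xs
  proof -
    have "(\<Sum>i\<in>UNIV. if (xs @ [i]) ! 0 = i then path_weight M n (xs @ [i]) else 0)
        = (\<Sum>i\<in>UNIV. if xs ! 0 = i then path_weight M n (xs @ [xs ! 0]) else 0)"
      by (rule sum.cong) (use that assms in \<open>auto simp: nth_append\<close>)
    then show ?thesis using path that by simp
  qed
  show ?thesis
    unfolding trace_def mprod_path_sum
    by (subst sum.swap) (intro sum.cong refl loop, simp)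
qed

section \<open>Sums and products over the prime field\<close>

context
  fixes p :: nat
  assumes prime: "prime p"
begin

lemma of_nat_neq_0:
  assumes "CHAR('a::field) = p" "0 < k" "k < p"
  shows "of_nat k \<noteq> (0::'a)"
  using assms by (auto simp: of_nat_eq_0_iff_char_dvd dest: dvd_imp_le)

lemma frobenius_add:
  assumes "CHAR('a::field) = p"
  shows "(x + y) ^ p = x ^ p + (y :: 'a) ^ p"
  using assms prime by (intro freshmans_dream) simp_all

lemma inj_on_of_nat_CHAR:
  assumes "CHAR('a::field) = p"
  shows "inj_on (of_nat :: nat \<Rightarrow> 'a) {..<p}"
proof (rule inj_onI)
  fix x y assume "x \<in> {..<p}" "y \<in> {..<p}" "(of_nat x :: 'a) = of_nat y"
  then show "x = y"
    using of_nat_neq_0[OF assms, of "x - y"] of_nat_neq_0[OF assms, of "y - x"]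
      less_imp_diff_less[of x p y] less_imp_diff_less[of y p x]
    by (cases x y rule: linorder_cases) auto
qed

lemma of_nat_power_CHAR:
  assumes "CHAR('a::field) = p"
  shows "of_nat n ^ p = (of_nat n :: 'a)"
proof (induction n)
  case 0
  then show ?case using prime by (simp add: prime_gt_0_nat)
next
  case (Suc n)
  then show ?case
    using frobenius_add[OF assms, of 1 "of_nat n"] by simp
qed

text \<open>Telescoping \<open>(s + 1) ^ (i + 1) - s ^ (i + 1)\<close> over the prime field gives 0.
  By induction only the term with exponent \<open>i\<close> survives the binomial expansion, and its
  coefficient \<open>i + 1\<close> is nonzero.\<close>

lemma power_sum_CHAR:
  assumes "CHAR('a::field) = p" "i + 1 < p"
  shows "(\<Sum>s<p. of_nat s ^ i) = (0::'a)"
  using assms(2)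
proof (induction i rule: less_induct)
  case (less i)
  let ?S = "\<lambda>i. \<Sum>s<p. (of_nat s ^ i :: 'a)"
  have p0: "of_nat p = (0::'a)" using assms(1) by (metis of_nat_CHAR)
  have "0 = (\<Sum>s<p. of_nat (Suc s) ^ Suc i - of_nat s ^ Suc i :: 'a)"
    by (subst sum_lessThan_telescope) (simp add: p0)
  also have "\<dots> = (\<Sum>s<p. \<Sum>k\<le>i. of_nat (Suc i choose k) * (of_nat s ^ k :: 'a))"
  proof (intro sum.cong refl)
    fix s
    have "(of_nat (Suc s) :: 'a) ^ Suc i = (\<Sum>k\<le>Suc i. of_nat (Suc i choose k) * of_nat s ^ k)"
      using binomial_ring[of "of_nat s :: 'a" 1 "Suc i"] by (simp add: add.commute)
    then show "of_nat (Suc s) ^ Suc i - of_nat s ^ Suc i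
        = (\<Sum>k\<le>i. of_nat (Suc i choose k) * (of_nat s ^ k :: 'a))"
      by (simp del: power_Suc binomial_Suc_Suc)
  qed
  also have "\<dots> = (\<Sum>k\<le>i. of_nat (Suc i choose k) * ?S k)"
    by (subst sum.swap) (simp add: sum_distrib_left)
  also have "\<dots> = of_nat (Suc i choose i) * ?S i"
    by (rule sum.mono_neutral_cong_right[where S = "{i}" and T = "{..i}", symmetric, THEN sym, THEN trans])
      (use less in auto)
  finally show ?case
    using of_nat_neq_0[OF assms(1), of "Suc i"] less.prems by simp
qed

lemma shifted_power_sum_low:
  assumes "CHAR('a::field) = p" "i + 1 < p"
  shows "(\<Sum>s<p. (z + of_nat s) ^ i) = (0::'a)"
proof -
  have "(\<Sum>s<p. (z + of_nat s) ^ i) = (\<Sum>k\<le>i. of_nat (i choose k) * z ^ k * (\<Sum>s<p. of_nat s ^ (i - k)))"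
    by (subst binomial_ring, subst sum.swap) (simp add: sum_distrib_left)
  also have "\<dots> = 0"
    by (intro sum.neutral ballI) (use power_sum_CHAR[OF assms(1)] assms(2) in simp)
  finally show ?thesis .
qed

text \<open>In the binomial expansion every term with a positive power of \<open>z\<close> carries a
  power sum of exponent below \<open>p - 1\<close>, which vanishes.\<close>

lemma shifted_power_sum_weighted:
  assumes "CHAR('a::field) = p" "i + 2 \<le> p"
  shows "(\<Sum>s<p. of_nat s * (z + of_nat s) ^ i) = (\<Sum>s<p. of_nat s * (of_nat s ^ i :: 'a))"
proof -
  have "(\<Sum>s<p. of_nat s * (z + of_nat s) ^ i)
      = (\<Sum>k\<le>i. of_nat (i choose k) * z ^ k * (\<Sum>s<p. of_nat s ^ Suc (i - k)))"
    by (subst binomial_ring, subst sum_distrib_left, subst sum.swap) (simp add: sum_distrib_left mult_ac)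
  also have "\<dots> = (\<Sum>k\<in>{0}. of_nat (i choose k) * z ^ k * (\<Sum>s<p. of_nat s ^ Suc (i - k)))"
    by (rule sum.mono_neutral_right)
      (use power_sum_CHAR[OF assms(1)] assms(2) in \<open>auto simp del: power_Suc\<close>)
  finally show ?thesis by simp
qed

text \<open>Below \<open>p - 1\<close> both sides vanish. For \<open>m = p - 1\<close> one factor
  \<open>z + s\<close> is split off; for larger \<open>m\<close> the factor
  \<open>(z + s) ^ p = z ^ p + s\<close> is. Either way an unweighted sum that vanishes and a
  weighted sum independent of \<open>z\<close> remain.\<close>

lemma shifted_power_sum:
  assumes "CHAR('a::field) = p" "m + 2 \<le> 2 * p"
  shows "(\<Sum>s<p. (z + of_nat s) ^ m) = (\<Sum>s<p. of_nat s ^ m :: 'a)"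
proof (cases "m + 1 < p")
  case True
  then show ?thesis
    using shifted_power_sum_low[OF assms(1)] power_sum_CHAR[OF assms(1)] by simp
next
  case False
  show ?thesis
  proof (cases "m + 1 = p")
    case True
    then obtain i where i: "m = Suc i" "i + 2 = p"
      using prime prime_gt_1_nat[of p] by (cases m) auto
    have "(\<Sum>s<p. (z + of_nat s) ^ m) = z * (\<Sum>s<p. (z + of_nat s) ^ i) + (\<Sum>s<p. of_nat s * (z + of_nat s) ^ i)"
      by (simp add: i sum_distrib_left sum.distrib distrib_right)
    then show ?thesis
      using shifted_power_sum_low[OF assms(1), of i z] shifted_power_sum_weighted[OF assms(1), of i z] i
      by simp
  next
    case neq: False
    then obtain i where i: "m = p + i" "i + 2 \<le> p"
      using False assms(2) le_Suc_ex[of p m] by auto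
    have split: "(z + of_nat s) ^ m = z ^ p * (z + of_nat s) ^ i + of_nat s * (z + of_nat s) ^ i" for z :: 'a and s
      using frobenius_add[OF assms(1), of z "of_nat s"] of_nat_power_CHAR[OF assms(1), of s]
      by (simp add: i power_add distrib_right)
    have "(\<Sum>s<p. (z + of_nat s) ^ m) = z ^ p * (\<Sum>s<p. (z + of_nat s) ^ i) + (\<Sum>s<p. of_nat s * (z + of_nat s) ^ i)"
      for z :: 'a
      by (simp add: split sum.distrib sum_distrib_left)
    from this[of z] this[of 0] show ?thesis
      using shifted_power_sum_low[OF assms(1), of i] shifted_power_sum_weighted[OF assms(1), of i z] i
      by simp
  qed
qed

lemma shifted_poly_sum:
  assumes "CHAR('a::field) = p" "degree Q + 2 \<le> 2 * p"
  shows "(\<Sum>s<p. poly Q (z + of_nat s)) = (\<Sum>s<p. poly Q (of_nat s :: 'a))"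
proof -
  have "(\<Sum>s<p. poly Q (z + of_nat s)) = (\<Sum>i\<le>degree Q. coeff Q i * (\<Sum>s<p. (z + of_nat s) ^ i))" for z
    unfolding poly_altdef by (subst sum.swap) (simp add: sum_distrib_left)
  from this[of z] this[of 0] show ?thesis
    using shifted_power_sum[OF assms(1), of _ z] assms(2) by simp
qed

text \<open>Both sides are monic polynomials of degree \<open>p\<close> in \<open>y\<close> that
  vanish at the \<open>p\<close> distinct points \<open>- k\<close>.\<close>

lemma prod_linear_CHAR:
  assumes "CHAR('a::field) = p"
  shows "(\<Prod>k<p. y + of_nat k) = y ^ p - (y :: 'a)"
proof -
  let ?P = "(\<Prod>k<p. [:of_nat k, 1:]) :: 'a poly" and ?Q = "monom 1 p - [:0, 1:] :: 'a poly"
  have p: "p > 1" using prime by (rule prime_gt_1_nat)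
  \<comment> \<open>True for \<open>p = 2\<close> too, since signs do not matter in characteristic
    2.\<close>
  have odd: "(- x) ^ p = - (x ^ p)" for x :: 'a
    using assms prime minus_power_prime_CHAR[of p x] by simp
  have "?P = ?Q"
  proof (rule poly_eqI_degree_lead_coeff[where n = p and A = "(\<lambda>k. - of_nat k) ` {..<p}"])
    have "degree ?P = p" "lead_coeff ?P = 1"
      by (subst degree_prod_eq_sum_degree) (simp_all add: lead_coeff_prod)
    then show "degree ?P \<le> p" "coeff ?P p = coeff ?Q p"
      using p by (simp_all add: coeff_pCons split: nat.splits)
    show "degree ?Q \<le> p"
      using p by (intro degree_diff_le) (auto simp: degree_monom_le)
    show "p \<le> card ((\<lambda>k. - of_nat k :: 'a) ` {..<p})"
      using inj_on_of_nat_CHAR[OF assms] by (subst card_image) (auto simp: inj_on_def)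
    fix z :: 'a assume "z \<in> (\<lambda>k. - of_nat k) ` {..<p}"
    then obtain k where k: "k < p" "z = - of_nat k" by auto
    have "poly ?P z = 0" using k by (auto simp: poly_prod)
    moreover have "poly ?Q z = 0"
      by (simp add: k poly_monom odd of_nat_power_CHAR[OF assms])
    ultimately show "poly ?P z = poly ?Q z" by simp
  qed
  then have "poly ?P y = poly ?Q y" by simp
  then show ?thesis by (simp add: poly_prod poly_monom add.commute)
qed

text \<open>For nonzero \<open>a\<close>, pull out \<open>a\<close> and apply the linear case at
  \<open>z + b / a\<close>; additivity of the Frobenius map separates the dependence on
  \<open>z\<close>.\<close>

lemma prod_affine_CHAR:
  assumes "CHAR('a::field) = p"
  shows "(\<Prod>k<p. a * (z + of_nat k) + b) = a ^ p * (z ^ p - z) + (\<Prod>k<p. a * of_nat k + (b :: 'a))"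
proof (cases "a = 0")
  case True
  then show ?thesis using prime by (simp add: prime_gt_0_nat)
next
  case False
  have *: "(\<Prod>k<p. a * (z + of_nat k) + b) = a ^ p * ((z + b / a) ^ p - (z + b / a))" for z
  proof -
    have "(\<Prod>k<p. a * (z + of_nat k) + b) = (\<Prod>k<p. a * (z + b / a + of_nat k))"
      using False by (intro prod.cong refl) (simp add: field_simps)
    then show ?thesis by (simp add: prod.distrib prod_linear_CHAR[OF assms])
  qed
  show ?thesis
    unfolding *[of z] *[of 0, unfolded add_0] frobenius_add[OF assms]
    by (simp add: algebra_simps)
qed

end

section \<open>Shifting the trace\<close>

lemma (in comm_monoid_set) cyclic_shift:
  "F (\<lambda>k. g (Suc k mod n)) {..<n} = F g {..<n}"
proof (cases n)
  case 0
  then show ?thesis by simp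
next
  case (Suc m)
  have "F (\<lambda>k. g (Suc k mod n)) {..<m} = F (\<lambda>k. g (Suc k)) {..<m}"
    by (rule cong) (auto simp: Suc)
  moreover have "F g {..<Suc m} = f (g 0) (F (\<lambda>k. g (Suc k)) {..<m})"
    by (rule lessThan_Suc_shift)
  ultimately show ?thesis
    by (simp add: Suc lessThan_Suc commute)
qed

lemma length_filter_rotate: "length (filter P (rotate m xs)) = length (filter P xs)"
proof (induction m)
  case (Suc m)
  have "length (filter P (rotate1 ys)) = length (filter P ys)" for ys :: "'a list"
    by (cases ys) auto
  with Suc show ?case by simp
qed simp

definition poly_mat :: "'a::field poly^'n^'n \<Rightarrow> 'a \<Rightarrow> nat \<Rightarrow> 'a^'n^'n" where
  "poly_mat q z k = (\<chi> i j. poly (q $ i $ j) (z + of_nat k))"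

text \<open>Rotating a closed path by one vertex pairs each edge with the factor of the preceding
  position, which adding 1 to \<open>z\<close> compensates. Wrapping around is harmless because
  positions enter only modulo \<open>p\<close>.\<close>

lemma loop_weight_rotate:
  fixes q :: "'a::field poly^'n^'n"
  assumes "of_nat p = (0::'a)" "length xs = p"
  shows "loop_weight (poly_mat q (z + of_nat m)) p (rotate m xs) = loop_weight (poly_mat q z) p xs"
proof -
  have mod: "of_nat (k mod p) = (of_nat k :: 'a)" for k
  proof -
    have "(of_nat k :: 'a) = of_nat (p * (k div p) + k mod p)"
      by (simp only: mult_div_mod_eq)
    also have "\<dots> = of_nat (k mod p)"
      by (simp only: of_nat_add of_nat_mult assms(1)) simp
    finally show ?thesis ..
  qed
  have *: "loop_weight (poly_mat q (z + 1)) p (rotate1 xs) = loop_weight (poly_mat q z) p xs"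
    if "length xs = p" for z and xs :: "'n list"
  proof -
    let ?G = "\<lambda>j. poly_mat q z j $ (xs ! (Suc j mod p)) $ (xs ! j)"
    have "loop_weight (poly_mat q (z + 1)) p (rotate1 xs) = (\<Prod>k<p. ?G (Suc k mod p))"
      unfolding loop_weight_def
    proof (intro prod.cong refl)
      fix k assume "k \<in> {..<p}"
      then show "poly_mat q (z + 1) k $ (rotate1 xs ! (Suc k mod p)) $ (rotate1 xs ! k) = ?G (Suc k mod p)"
        using that by (simp add: poly_mat_def nth_rotate1 mod add.assoc)
    qed
    also have "\<dots> = (\<Prod>k<p. ?G k)" by (rule prod.cyclic_shift)
    finally show ?thesis by (simp add: loop_weight_def)
  qed
  show ?thesis
    using assms(2)
  proof (induction m)
    case (Suc m)
    then show ?case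
      using *[of "rotate m xs" "z + of_nat m"] by (simp add: add_ac)
  qed simp
qed

text \<open>Averaging over the positions of a fixed letter makes it the first letter; this replaces
  a sum over rotation orbits.\<close>

lemma sum_rotations:
  fixes F :: "'n list \<Rightarrow> 'b::field"
  assumes fin: "finite N" and len: "\<And>xs. xs \<in> N \<Longrightarrow> length xs = p" and "p > 0"
    and rot: "\<And>xs m. xs \<in> N \<Longrightarrow> rotate m xs \<in> N"
    and F': "\<And>xs m. xs \<in> N \<Longrightarrow> F' m (rotate m xs) = F xs"
    and nz: "\<And>xs. xs \<in> N \<Longrightarrow> of_nat (length (filter ((=) a) xs)) \<noteq> (0::'b)"
  shows "(\<Sum>xs\<in>N. F xs) = (\<Sum>xs\<in>N. if xs ! 0 = a
      then (\<Sum>m<p. F' m xs) / of_nat (length (filter ((=) a) xs)) else 0)"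
proof -
  let ?c = "\<lambda>xs. of_nat (length (filter ((=) a) xs)) :: 'b"
  have F: "F xs = (\<Sum>m<p. if xs ! m = a then F xs / ?c xs else 0)" if "xs \<in> N" for xs
  proof -
    have "(\<Sum>m<p. if xs ! m = a then F xs / ?c xs else 0) = (\<Sum>m | m < p \<and> xs ! m = a. F xs / ?c xs)"
      by (simp add: sum.If_cases Int_def)
    also have "\<dots> = ?c xs * (F xs / ?c xs)"
      using len[OF that] by (simp add: length_filter_conv_card eq_commute[of a])
    finally show ?thesis using nz[OF that] by simp
  qed
  have bij: "bij_betw (rotate m) N N" for m
  proof -
    have "inj (rotate m)" unfolding rotate_def by (rule inj_fn[OF inj_rotate1])
    then have inj: "inj_on (rotate m) N" by (rule inj_on_subset) simp
    then show ?thesis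
      unfolding bij_betw_def using endo_inj_surj[OF fin _ inj] rot by blast
  qed
  have "(\<Sum>xs\<in>N. F xs) = (\<Sum>m<p. \<Sum>xs\<in>N. if xs ! m = a then F xs / ?c xs else 0)"
    using F by (subst sum.swap) (rule sum.cong, auto)
  also have "\<dots> = (\<Sum>m<p. \<Sum>xs\<in>N. if xs ! 0 = a then F' m xs / ?c xs else 0)"
  proof (rule sum.cong[OF refl])
    fix m assume m: "m \<in> {..<p}"
    have "(\<Sum>xs\<in>N. if xs ! 0 = a then F' m xs / ?c xs else 0)
        = (\<Sum>xs\<in>N. if rotate m xs ! 0 = a then F' m (rotate m xs) / ?c (rotate m xs) else 0)"
      by (rule sum.reindex_bij_betw[OF bij, symmetric])
    also have "\<dots> = (\<Sum>xs\<in>N. if xs ! m = a then F xs / ?c xs else 0)"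
    proof (rule sum.cong[OF refl])
      fix xs assume xs: "xs \<in> N"
      then have "rotate m xs ! 0 = xs ! m"
        using m \<open>p > 0\<close> len[OF xs] by (subst nth_rotate) auto
      then show "(if rotate m xs ! 0 = a then F' m (rotate m xs) / ?c (rotate m xs) else 0)
          = (if xs ! m = a then F xs / ?c xs else 0)"
        using F'[OF xs] by (simp add: length_filter_rotate)
    qed
    finally show "(\<Sum>xs\<in>N. if xs ! m = a then F xs / ?c xs else 0)
        = (\<Sum>xs\<in>N. if xs ! 0 = a then F' m xs / ?c xs else 0)" ..
  qed
  also have "\<dots> = (\<Sum>xs\<in>N. if xs ! 0 = a then (\<Sum>m<p. F' m xs) / ?c xs else 0)"
    by (subst sum.swap) (rule sum.cong, auto simp: sum_divide_distrib)
  finally show ?thesis .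
qed

text \<open>The two constant paths are products of affine factors and carry all dependence on
  \<open>z\<close>. The sum over the remaining paths is rewritten as sums over all shifts by the
  prime field.\<close>

lemma trace_mprod_poly_mat_shift:
  fixes q :: "'a::field poly^2^2"
  assumes p: "prime p" "p \<noteq> 2" "CHAR('a) = p"
    and deg: "degree (q $ 1 $ 1) \<le> 1" "degree (q $ 1 $ 2) \<le> 1"
      "degree (q $ 2 $ 1) \<le> 2" "degree (q $ 2 $ 2) \<le> 1"
  shows "trace (mprod (poly_mat q z) p) = trace (mprod (poly_mat q 0) p)
    + (coeff (q $ 1 $ 1) 1 ^ p + coeff (q $ 2 $ 2) 1 ^ p) * (z ^ p - z)"
proof -
  have p3: "p \<ge> 3" using p prime_ge_2_nat[of p] by linarith
  have p0: "of_nat p = (0::'a)" using p(3) by (metis of_nat_CHAR)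
  let ?F = "\<lambda>z. loop_weight (poly_mat q z) p"
  define N :: "2 list set" where "N = {xs. length xs = p \<and> 1 \<in> set xs \<and> 2 \<in> set xs}"
  have fin: "finite N"
    unfolding N_def by (rule finite_subset[OF _ finite_lists_length_UNIV[of p]]) auto
  have lists: "{xs :: 2 list. length xs = p} = insert (replicate p 1) (insert (replicate p 2) N)"
  proof (intro equalityI subsetI)
    fix xs :: "2 list" assume "xs \<in> {xs. length xs = p}"
    moreover have "xs = replicate p 1" if "length xs = p" "2 \<notin> set xs"
      using that by (intro replicate_eqI) (use exhaust_2 in metis)+
    moreover have "xs = replicate p 2" if "length xs = p" "1 \<notin> set xs"
      using that by (intro replicate_eqI) (use exhaust_2 in metis)+
    ultimately show "xs \<in> insert (replicate p 1) (insert (replicate p 2) N)"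
      by (auto simp: N_def)
  qed (auto simp: N_def)
  have "replicate p 1 \<noteq> replicate p (2::2)"
    using p3 by (simp add: replicate_eq_replicate)
  then have split: "trace (mprod (poly_mat q z) p)
      = ?F z (replicate p 1) + ?F z (replicate p 2) + (\<Sum>xs\<in>N. ?F z xs)" for z
    using p3 fin by (simp add: trace_mprod_loop_sum lists N_def add.assoc)
  have const: "?F z (replicate p i) = coeff (q $ i $ i) 1 ^ p * (z ^ p - z) + ?F 0 (replicate p i)"
    if "degree (q $ i $ i) \<le> 1" for i
  proof -
    have "q $ i $ i = [:coeff (q $ i $ i) 0, coeff (q $ i $ i) 1:]"
      using that by (intro poly_eqI) (auto simp: coeff_pCons coeff_eq_0 split: nat.splits)
    then obtain a b where q: "q $ i $ i = [:b, a:]" by blast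
    then have "?F z (replicate p i) = (\<Prod>k<p. a * (z + of_nat k) + b)" for z
      unfolding loop_weight_def poly_mat_def using p3 by (simp add: algebra_simps)
    from this[of z] this[of 0] show ?thesis
      using prod_affine_CHAR[OF p(1) p(3), of a z b] by (simp add: q)
  qed
  have shift_sum: "(\<Sum>m<p. ?F (z + of_nat m) xs) = (\<Sum>m<p. ?F (of_nat m) xs)" if "xs \<in> N" for xs z
  proof -
    let ?q = "\<lambda>k. q $ (xs ! (Suc k mod p)) $ (xs ! k)"
    define Q where "Q = (\<Prod>k<p. pcompose (?q k) [:of_nat k, 1:])"
    \<comment> \<open>Only the entry (2,1) can be quadratic, and a closed path uses it as often as the
      linear entry (1,2); the potential \<open>\<phi>\<close> records this balance.\<close>
    define \<phi> where "\<phi> i = (if i = (1::2) then 0 else 1 :: nat)" for i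
    have "2 * degree (q $ i $ j) + \<phi> j \<le> 3 + \<phi> i" for i j
      using deg exhaust_2[of i] exhaust_2[of j] by (auto simp: \<phi>_def)
    then have "(\<Sum>k<p. 2 * degree (?q k) + \<phi> (xs ! k)) \<le> (\<Sum>k<p. 3 + \<phi> (xs ! (Suc k mod p)))"
      by (rule sum_mono)
    then have "2 * (\<Sum>k<p. degree (?q k)) \<le> 3 * p"
      using sum.cyclic_shift[of "\<lambda>k. \<phi> (xs ! k)" p] by (simp add: sum.distrib sum_distrib_left)
    moreover have "degree Q \<le> (\<Sum>k<p. degree (?q k))"
      unfolding Q_def by (rule order.trans[OF degree_prod_sum_le]) (simp_all add: degree_pcompose)
    \<comment> \<open>Integrality matters for \<open>p = 3\<close>: twice the degree is at most 9,
      so the degree is at most 4. For \<open>p = 2\<close> the bound would fail.\<close>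
    ultimately have "degree Q + 2 \<le> 2 * p"
      using p3 by linarith
    moreover have "?F z xs = poly Q z" for z
      by (simp add: loop_weight_def poly_mat_def Q_def poly_prod poly_pcompose add.commute)
    ultimately show ?thesis
      using shifted_poly_sum[OF p(1) p(3)] by simp
  qed
  have nonconst: "(\<Sum>xs\<in>N. ?F z xs) = (\<Sum>xs\<in>N. if xs ! 0 = 1
      then (\<Sum>m<p. ?F (z + of_nat m) xs) / of_nat (length (filter ((=) 1) xs)) else 0)" for z
  proof (rule sum_rotations[OF fin])
    fix xs assume xs: "xs \<in> N"
    \<comment> \<open>Both letters occur, so the number of ones lies strictly between 0 and
      \<open>p\<close> and is invertible in characteristic \<open>p\<close>.\<close>
    have "length (filter ((=) 1) xs) < p"
      using xs length_filter_less[of 2 xs "(=) 1"] by (auto simp: N_def)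
    moreover have "0 < length (filter ((=) 1) xs)"
      using xs by (auto simp: N_def filter_empty_conv)
    ultimately show "of_nat (length (filter ((=) 1) xs)) \<noteq> (0::'a)"
      using of_nat_neq_0[OF p(1) p(3)] by blast
  qed (use p3 loop_weight_rotate[OF p0] in \<open>auto simp: N_def\<close>)
  have "(\<Sum>xs\<in>N. ?F z xs) = (\<Sum>xs\<in>N. ?F 0 xs)"
    unfolding nonconst[of z] nonconst[of 0] add_0 by (rule sum.cong) (simp_all add: shift_sum)
  then show ?thesis
    unfolding split[of z] split[of 0] const[OF deg(1)] const[OF deg(4)] by (simp add: algebra_simps)
qed

lemma cyc_shift_odd:
  fixes z :: "'a::field"
  assumes p: "prime p" "p \<noteq> 2" "CHAR('a) = p"
  shows "cyc p x1 x2 x3 (b1 + z) (b2 + z) (b3 + z)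
    = cyc p x1 x2 x3 b1 b2 b3 + (x1 + x2 + x3) ^ p * (z ^ p - z)"
proof -
  \<comment> \<open>One period as a matrix polynomial in \<open>z\<close>. Its diagonal has linear
    coefficients \<open>x1 + x3\<close> and \<open>x2\<close>, whose \<open>p\<close>-th powers add
    up to that of \<open>x1 + x2 + x3\<close>.\<close>
  define q where "q = mat2 [:x1 * x2 * x3 + b2 * x3 + x1 * b3, x1 + x3:] [:x1 * x2 + b2, 1:]
    [:b1 * x2 * x3 + b1 * b3, x2 * x3 + b1 + b3, 1:] [:b1 * x2, x2:]"
  have "Lmat x1 (b1 + y + of_nat n) ** Lmat x2 (b2 + y + of_nat n) ** Lmat x3 (b3 + y + of_nat n)
      = poly_mat q y n" for y n
    by (simp add: Lmat_def mat2_mult vec_eq_iff forall_2 poly_mat_def q_def algebra_simps)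
  note q = this this[of 0, simplified]
  have "(x1 + x2 + x3) ^ p = (x1 + x3) ^ p + x2 ^ p"
    using frobenius_add[OF p(1) p(3), of "x1 + x3" x2] by (simp add: add_ac)
  then show ?thesis
    unfolding cyc_def q
    using trace_mprod_poly_mat_shift[OF p, of q z] by (simp add: q_def)
qed

lemma cyc_shift_2:
  fixes z :: "'a::field"
  assumes "CHAR('a) = 2"
  shows "cyc 2 x1 x2 x3 (b1 + z) (b2 + z) (b3 + z)
    = cyc 2 x1 x2 x3 b1 b2 b3 + (1 + (x1 + x2 + x3) ^ 2) * (z ^ 2 - z)"
proof -
  have 2: "(2::'a) = 0" using assms of_nat_CHAR[where ?'a = 'a] by simp
  define A B K N M D E where "A = x1 * x2 * x3 + b2 * x3 + x1 * b3" and "B = x1 + x3"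
    and "K = x1 * x2 + b2" and "N = b1 * x2 * x3 + b1 * b3" and "M = x2 * x3 + b1 + b3"
    and "D = b1 * x2" and "E = x2"
  define C where "C y = mat2 (A + B * y) (K + y) (N + M * y + y ^ 2) (D + E * y)" for y
  have C: "Lmat x1 (b1 + y + of_nat n) ** Lmat x2 (b2 + y + of_nat n) ** Lmat x3 (b3 + y + of_nat n)
      = C (y + of_nat n)" for y n
    by (simp add: Lmat_def mat2_mult C_def A_def B_def K_def N_def M_def D_def E_def
        algebra_simps power2_eq_square)
  have T: "cyc 2 x1 x2 x3 (b1 + y) (b2 + y) (b3 + y)
      = (A + B * (y + 1)) * (A + B * y) + (K + (y + 1)) * (N + M * y + y ^ 2)
      + (N + M * (y + 1) + (y + 1) ^ 2) * (K + y) + (D + E * (y + 1)) * (D + E * y)" for y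
    unfolding cyc_def C
    by (simp add: numeral_2_eq_2 trace_def sum_2 C_def mat2_mult del: One_nat_def)
  \<comment> \<open>Half of the discrepancy between the two sides; the identity below holds as a
    polynomial identity, and characteristic 2 then removes \<open>2 * R\<close>.\<close>
  define R where "R = A * B * z + B ^ 2 * z + D * E * z + E ^ 2 * z + z ^ 3 + (K + M + 1) * z ^ 2
    + (K * M + M + N + K + 1) * z - B * E * (z ^ 2 - z)"
  have "cyc 2 x1 x2 x3 (b1 + z) (b2 + z) (b3 + z)
      = cyc 2 x1 x2 x3 (b1 + 0) (b2 + 0) (b3 + 0) + (1 + (B + E) ^ 2) * (z ^ 2 - z) + 2 * R"
    unfolding T R_def by (simp add: algebra_simps power2_eq_square power3_eq_cube)
  then show ?thesis
    by (simp add: 2 B_def E_def add_ac)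
qed

definition shift_coeff :: "nat \<Rightarrow> 'a::field \<Rightarrow> 'a" where
  "shift_coeff p t = (if p = 2 then 1 + t ^ 2 else t ^ p)"

lemma cyc_shift:
  fixes z :: "'a::field"
  assumes "prime p" "CHAR('a) = p"
  shows "cyc p x1 x2 x3 (b1 + z) (b2 + z) (b3 + z)
    = cyc p x1 x2 x3 b1 b2 b3 + shift_coeff p (x1 + x2 + x3) * (z ^ p - z)"
  using cyc_shift_odd[OF assms(1) _ assms(2)] cyc_shift_2 assms(2)
  by (auto simp: shift_coeff_def)

section \<open>Action of the Weyl group\<close>

lemma ring_map_mprod:
  fixes M :: "nat \<Rightarrow> 'a::field^2^2" and h :: "'a \<Rightarrow> 'b::field"
  assumes "ring_map h" "\<And>k i j. h (M k $ i $ j) = M' k $ i $ j"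
  shows "h (mprod M n $ i $ j) = mprod M' n $ i $ j"
proof (induction n arbitrary: i j)
  case 0
  show ?case by (simp add: mat_def ring_map.hom_simps[OF assms(1)])
next
  case (Suc n)
  then show ?case
    by (simp add: matrix_matrix_mult_def sum_2 ring_map.hom_simps[OF assms(1)] assms(2))
qed

lemma ring_map_cyc:
  fixes h :: "'a::field \<Rightarrow> 'b::field"
  assumes "ring_map h"
  shows "h (cyc p x1 x2 x3 b1 b2 b3) = cyc p (h x1) (h x2) (h x3) (h b1) (h b2) (h b3)"
proof -
  have "h ((Lmat x1 (b1 + of_nat k) ** Lmat x2 (b2 + of_nat k) ** Lmat x3 (b3 + of_nat k)) $ i $ j)
      = (Lmat (h x1) (h b1 + of_nat k) ** Lmat (h x2) (h b2 + of_nat k) ** Lmat (h x3) (h b3 + of_nat k)) $ i $ j"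
    for k and i j :: 2
    using exhaust_2[of i] exhaust_2[of j]
    by (auto simp: Lmat_def mat2_mult ring_map.hom_simps[OF assms])
  from ring_map_mprod[OF assms this] show ?thesis
    unfolding cyc_def trace_def sum_2 by (simp add: ring_map.add[OF assms])
qed

text \<open>The three \<open>x\<close> arguments add up to \<open>t\<close>, so the effect of a
  shift of \<open>z\<close> depends on \<open>t\<close> alone. The last parameter is normalised to
  0, which fixes the freedom of a common shift.\<close>

definition weyl_trace :: "nat \<Rightarrow> 'a::field \<Rightarrow> 'a \<Rightarrow> 'a \<Rightarrow> 'a \<Rightarrow> 'a \<Rightarrow> 'a" where
  "weyl_trace p f g a1 a2 t = cyc p (f - g + t) g (- f) (1 - a1) a2 0"

lemma Ip_eq_weyl_trace:
  assumes "of_nat p = (0 :: 'k::field F5)"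
  shows "(Ip p :: 'k F5) = weyl_trace p var_f var_g var_a1 var_a2 var_t"
proof -
  define H :: "nat \<Rightarrow> 'k F5^2^2" where
    "H n = mat2 (var_t * of_nat n - var_g + var_t * var_f * var_g) 1 (of_nat n - var_a1) 0" for n
  have "prodA n = mprod (\<lambda>n. Amat 1 (of_nat n) :: 'k F5^2^2) n" for n
    by (induction n) simp_all
  moreover have "trace (mprod (\<lambda>n. Amat 1 (of_nat n) :: 'k F5^2^2) p)
      = weyl_trace p var_f var_g var_a1 var_a2 var_t"
    unfolding weyl_trace_def cyc_def
  proof (rule trace_mprod_gauge)
    \<comment> \<open>\<open>H n\<close> is the right triangular-type factor of \<open>A\<close> at
      \<open>n\<close>. Multiplying \<open>H (n + 1)\<close> by the leftmost factor of
      \<open>A\<close> cancels the terms in \<open>t * n\<close> and \<open>t * f * g\<close>,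
      leaving \<open>f - g + t\<close>.\<close>
    show "H (Suc n) ** Amat 1 (of_nat n) = Lmat (var_f - var_g + var_t) (1 - var_a1 + of_nat n)
        ** Lmat var_g (var_a2 + of_nat n) ** Lmat (- var_f) (0 + of_nat n) ** H n" for n
      by (simp add: H_def Amat_def Lmat_def mat2_mult algebra_simps)
  qed (simp_all add: H_def assms invertible_mat2 var_nonzero)
  ultimately show ?thesis
    by (simp only: Ip_def)
qed

section \<open>Effect of the generators on the uncorrected trace\<close>

context
  fixes p :: nat and f g a1 a2 t :: "'a::field"
  assumes p: "prime p" "CHAR('a) = p"
begin

text \<open>The map \<open>x ^ p - x\<close> is additive and kills 1, so the affine action on the
  parameters becomes linear on the correction term.\<close>

lemma artin_schreier:
  fixes x y :: 'a
  shows "(x + y) ^ p - (x + y) = (x ^ p - x) + (y ^ p - y)"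
    "(- x) ^ p - (- x) = - (x ^ p - x)"
    "(1 - x) ^ p - (1 - x) = - (x ^ p - x)"
    "(1 + x) ^ p - (1 + x) = x ^ p - x"
proof -
  show add: "(x + y) ^ p - (x + y) = (x ^ p - x) + (y ^ p - y)" for x y :: 'a
    using frobenius_add[OF p, of x y] by simp
  show neg: "(- x) ^ p - (- x) = - (x ^ p - x)" for x :: 'a
    using minus_power_prime_CHAR[of p x] p by simp
  show "(1 - x) ^ p - (1 - x) = - (x ^ p - x)" "(1 + x) ^ p - (1 + x) = x ^ p - x"
    using add[of 1 "- x"] add[of 1 x] neg[of x] by simp_all
qed

lemma p0: "of_nat p = (0::'a)"
  using p(2) by (metis of_nat_CHAR)

text \<open>A swap of the first two factors; the parameter 0 stays in place, so no shift of
  \<open>z\<close> arises.\<close>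

lemma weyl_trace_s0:
  assumes "f - g + t \<noteq> 0"
  defines "\<delta> \<equiv> (a1 + a2 - 1) / (f - g + t)"
  shows "weyl_trace p (f + \<delta>) (g + \<delta>) (1 - a2) (1 - a1) t = weyl_trace p f g a1 a2 t"
proof -
  have "(1 - a1 - a2) / (f - g + t) = - \<delta>"
    by (simp add: \<delta>_def diff_divide_distrib add_divide_distrib)
  then show ?thesis
    using cyc_swap[OF assms(1), of p g "- f" "1 - a1" a2 0] by (simp add: weyl_trace_def)
qed

text \<open>Two rotations bring the factor of \<open>- f\<close> in front of that of
  \<open>f - g + t\<close>; these are swapped, one more rotation restores the order, and the shift
  by \<open>1 + a1\<close> restores the parameter 0.\<close>

lemma weyl_trace_s1:
  assumes "f \<noteq> 0" "a1 \<noteq> 0" "a2 \<noteq> 1" "1 + a1 \<noteq> 0"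
  shows "weyl_trace p f (g - a1 / f) (- a1) (a1 + a2) t
    = weyl_trace p f g a1 a2 t + shift_coeff p t * (a1 ^ p - a1)"
proof -
  have "weyl_trace p f g a1 a2 t = cyc p (- f) (f - g + t) g 0 (- a1) (a2 - 1)"
    using assms cyc_rotate[OF p0, of "1 - a1"] cyc_rotate[OF p0, of a2]
    by (simp add: weyl_trace_def)
  also have "\<dots> = cyc p (- f) (f - g + t + a1 / f) (g - a1 / f) (- a1) 0 (a2 - 1)"
    using cyc_swap[of "- f" p "f - g + t" g 0 "- a1" "a2 - 1"] assms by simp
  also have "\<dots> = cyc p (f - g + t + a1 / f) (g - a1 / f) (- f) 0 (a2 - 1) (- a1 - 1)"
    using assms by (intro cyc_rotate[OF p0]) (simp add: neg_eq_iff_add_eq_0 add.commute)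
  finally have *: "weyl_trace p f g a1 a2 t = \<dots>" .
  show ?thesis
    using cyc_shift[OF p, of "f - g + t + a1 / f" "g - a1 / f" "- f" 0 "1 + a1" "a2 - 1" "- a1 - 1"]
    unfolding * artin_schreier(4) by (simp add: weyl_trace_def algebra_simps)
qed

text \<open>One rotation, a swap of the factors of \<open>g\<close> and \<open>- f\<close>, two more
  rotations, and a normalising shift by \<open>1 - a2\<close>.\<close>

lemma weyl_trace_s2:
  assumes "g \<noteq> 0" "a1 \<noteq> 0" "a2 \<noteq> 1"
  shows "weyl_trace p (f + a2 / g) g (a1 + a2) (- a2) t
    = weyl_trace p f g a1 a2 t - shift_coeff p t * (a2 ^ p - a2)"
proof -
  have "weyl_trace p f g a1 a2 t = cyc p g (- f) (f - g + t) a2 0 (- a1)"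
    using assms cyc_rotate[OF p0, of "1 - a1"] by (simp add: weyl_trace_def)
  also have "\<dots> = cyc p g (- f - a2 / g) (f - g + t + a2 / g) 0 a2 (- a1)"
    using cyc_swap[of g p "- f" "f - g + t" a2 0 "- a1"] assms by simp
  also have "\<dots> = cyc p (f - g + t + a2 / g) g (- f - a2 / g) (- a1) (- 1) (a2 - 1)"
    using assms cyc_rotate[OF p0, of 0 g "- f - a2 / g" "f - g + t + a2 / g" a2 "- a1"]
      cyc_rotate[OF p0, of a2 "- f - a2 / g" "f - g + t + a2 / g" g "- a1" "- 1"] by simp
  finally have *: "weyl_trace p f g a1 a2 t = \<dots>" .
  show ?thesis
    using cyc_shift[OF p, of "f - g + t + a2 / g" g "- f - a2 / g" "- a1" "1 - a2" "- 1" "a2 - 1"]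
    unfolding * artin_schreier(3) by (simp add: weyl_trace_def algebra_simps)
qed

text \<open>Two rotations already produce the image word, up to the shift by
  \<open>1 - a2\<close>.\<close>

lemma weyl_trace_pi:
  assumes "a1 \<noteq> 0" "a2 \<noteq> 1"
  shows "weyl_trace p (- g) (f - g + t) a2 (1 - a1 - a2) t
    = weyl_trace p f g a1 a2 t - shift_coeff p t * (a2 ^ p - a2)"
proof -
  have *: "weyl_trace p f g a1 a2 t = cyc p (- f) (f - g + t) g 0 (- a1) (a2 - 1)"
    using assms cyc_rotate[OF p0, of "1 - a1"] cyc_rotate[OF p0, of a2]
    by (simp add: weyl_trace_def)
  show ?thesis
    using cyc_shift[OF p, of "- f" "f - g + t" g 0 "1 - a2" "- a1" "a2 - 1"]
    unfolding * artin_schreier(3) by (simp add: weyl_trace_def algebra_simps)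
qed

end

section \<open>Invariance of the corrected trace\<close>

context
  fixes p :: nat
  assumes p: "prime p" "p \<noteq> 3" "CHAR('k::field) = p"
begin

lemma CHAR_F5: "CHAR('k F5) = p"
proof -
  have "of_nat p = (kconst (of_nat p) :: 'k F5)"
    by (simp only: ring_map.of_nat[OF ring_map_kconst])
  also have "\<dots> = 0"
    using p(3) ring_map.zero[OF ring_map_kconst[where ?'k = 'k]] by (metis of_nat_CHAR)
  finally have "CHAR('k F5) dvd p" by (simp add: of_nat_eq_0_iff_char_dvd)
  then show ?thesis
    using p(1) CHAR_not_1'[where ?'a = "'k F5"] by (auto simp: prime_nat_iff)
qed

lemma three_neq_0: "(3 :: 'k F5) \<noteq> 0"
proof
  assume "(3 :: 'k F5) = 0"
  then have "p dvd 3"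
    using of_nat_eq_0_iff_char_dvd[where ?'a = "'k F5", of 3] CHAR_F5 by simp
  then show False
    using p(1,2) primes_dvd_imp_eq[of p 3] by simp
qed

lemma Ip: "(Ip p :: 'k F5) = weyl_trace p var_f var_g var_a1 var_a2 var_t"
  by (rule Ip_eq_weyl_trace[OF p0[OF p(1) CHAR_F5]])

text \<open>Merges both cases of the definition: in characteristic 2 the factor \<open>1 / 3\<close>
  is 1 and minus signs can be read as plus signs.\<close>

lemma Itilde_eq:
  "(Itilde p :: 'k F5) = weyl_trace p var_f var_g var_a1 var_a2 var_t
    + 1 / 3 * shift_coeff p var_t * ((var_a1 ^ p - var_a1) - (var_a2 ^ p - var_a2))"
proof (cases "p = 2")
  case True
  have 2: "(2 :: 'k F5) = 0"
    using CHAR_F5 True of_nat_CHAR[where ?'a = "'k F5"] by simp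
  have "(3 :: 'k F5) = 2 + 1" by simp
  then have 3: "(3 :: 'k F5) = 1" unfolding 2 by simp
  have minus: "x - y = x + y" for x y :: "'k F5"
  proof -
    have "x - y = x + y - 2 * y" by simp
    then show ?thesis unfolding 2 by simp
  qed
  show ?thesis
    unfolding Itilde_def minus shift_coeff_def 3 using Ip by (simp add: True add_ac)
next
  case False
  then show ?thesis
    by (simp add: Itilde_def Ip shift_coeff_def)
qed

lemma ring_map_Itilde:
  fixes h :: "'k F5 \<Rightarrow> 'k F5"
  assumes "ring_map h" "h var_t = var_t"
  shows "h (Itilde p) = weyl_trace p (h var_f) (h var_g) (h var_a1) (h var_a2) var_t
    + 1 / 3 * shift_coeff p var_t * ((h var_a1 ^ p - h var_a1) - (h var_a2 ^ p - h var_a2))"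
  using assms(2) by (simp add: Itilde_eq weyl_trace_def ring_map_cyc[OF assms(1)]
      ring_map_divide[OF assms(1)] shift_coeff_def ring_map.hom_simps[OF assms(1)])

lemma Wgens_Itilde:
  assumes "s \<in> Wgens"
  shows "inj s" "s (Itilde p) = (Itilde p :: 'k F5)"
proof -
  \<comment> \<open>Here \<open>x\<close> and \<open>y\<close> stand for \<open>a1 ^ p - a1\<close>
    and \<open>a2 ^ p - a2\<close>. Each generator changes the bracket by three times the shift
    picked up by the trace, with opposite sign, which explains the coefficient \<open>1 / 3\<close>.
    The lines belong to \<open>s1\<close>, \<open>s2\<close> and \<open>piW\<close>.\<close>
  have third: "v + c * x + 1 / 3 * c * (- x - (x + y)) = v + 1 / 3 * c * (x - y)"
    "v - c * y + 1 / 3 * c * (x + y - - y) = v + 1 / 3 * c * (x - y)"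
    "v - c * y + 1 / 3 * c * (y - - (x + y)) = v + 1 / 3 * c * (x - y)" for v c x y :: "'k F5"
  proof -
    define e where "e = 1 / 3 * c"
    have "c = 3 * e"
      using three_neq_0 by (simp add: e_def)
    also have "\<dots> = e + e + e"
      by simp
    finally have c: "c = e + e + e" .
    show "v + c * x + 1 / 3 * c * (- x - (x + y)) = v + 1 / 3 * c * (x - y)"
      "v - c * y + 1 / 3 * c * (x + y - - y) = v + 1 / 3 * c * (x - y)"
      "v - c * y + 1 / 3 * c * (y - - (x + y)) = v + 1 / 3 * c * (x - y)"
      unfolding e_def[symmetric] by (simp_all add: c algebra_simps)
  qed
  note AS = artin_schreier[OF p(1) CHAR_F5]
  consider "s = s0" | "s = s1" | "s = s2" | "s = piW"
    using assms by (auto simp: Wgens_def)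
  then have "ring_map s \<and> s (Itilde p) = Itilde p"
  proof cases
    case 1
    have "s0 (Itilde p) = (Itilde p :: 'k F5)"
      unfolding ring_map_Itilde[OF s0_hom(1,6)]
      unfolding s0_hom(2-5) AS Itilde_eq
      using weyl_trace_s0[OF p(1) CHAR_F5 var_lin_nonzero(1), of var_a1 var_a2]
      by simp
    then show ?thesis by (simp add: 1 s0_hom(1))
  next
    case 2
    have "s1 (Itilde p) = (Itilde p :: 'k F5)"
      unfolding ring_map_Itilde[OF s1_hom(1,6)]
      unfolding s1_hom(2-5) AS Itilde_eq
        weyl_trace_s1[OF p(1) CHAR_F5 var_nonzero(1,3) var_lin_nonzero(3,2)]
      by (rule third)
    then show ?thesis by (simp add: 2 s1_hom(1))
  next
    case 3
    have "s2 (Itilde p) = (Itilde p :: 'k F5)"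
      unfolding ring_map_Itilde[OF s2_hom(1,6)]
      unfolding s2_hom(2-5) AS Itilde_eq
        weyl_trace_s2[OF p(1) CHAR_F5 var_nonzero(2,3) var_lin_nonzero(3)]
      by (rule third)
    then show ?thesis by (simp add: 3 s2_hom(1))
  next
    case 4
    have "piW (Itilde p) = (Itilde p :: 'k F5)"
      unfolding ring_map_Itilde[OF piW_hom(1,6)]
      unfolding piW_hom(2-5) Itilde_eq weyl_trace_pi[OF p(1) CHAR_F5 var_nonzero(3) var_lin_nonzero(3)]
      unfolding diff_diff_eq[of 1 var_a1 var_a2] AS
      by (rule third)
    then show ?thesis by (simp add: 4 piW_hom(1))
  qed
  then show "inj s" "s (Itilde p) = (Itilde p :: 'k F5)"
    using ring_map_inj by blast+
qed

end

theorem theorem2p3: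
  fixes p :: nat and w :: "'k::field F5 \<Rightarrow> 'k F5"
  assumes "prime p" and "p \<noteq> 3" and "CHAR('k) = p"
    and "w \<in> Wgroup"
  shows "w (Itilde p :: 'k F5) = Itilde p"
  using assms(4)
proof (induction rule: Wgroup.induct)
  \<comment> \<open>Since \<open>s\<close> is injective, \<open>inv s (s x) = x\<close>; as
    \<open>s\<close> fixes the invariant, so does \<open>inv s\<close>.\<close>
  case (Winv w s)
  then show ?case
    using inv_f_f[OF Wgens_Itilde(1)[OF assms(1-3)], of s "Itilde p"] Wgens_Itilde(2)[OF assms(1-3), of s]
    by simp
qed (simp_all add: Wgens_Itilde(2)[OF assms(1-3)])

end
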